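(* Let $\Delta\ge 6$ and let $n=k\Delta+1+j$, where $k\geq\Delta-1$ and $1\leq j\leq\Delta-1$ are integers. Let $T'\in\mathcal{T}'_{n,\Delta}$, $T''\in\mathcal{T}''_{n,\Delta}$, and in the case $2\leq j\leq\Delta-2$ let also $T'''\in\mathcal{T}'''_{n,\Delta}$. Then \[ \sigma(T')=\begin{cases} \Delta^{3}k-2\Delta^{2}k-3\Delta k+6k+4\Delta-6 & \text{for } j\leq 2,\\ \Delta^{3}k-2\Delta^{2}k-3\Delta k+6k+2\Delta j+j^{3}-4j^{2}+j & \text{for } j\geq 3, \end{cases} \] \[ \sigma(T'')=\Delta^{3}k-2\Delta^{2}k-3\Delta k+6k-\Delta^{3}+2\Delta^{2}j+6\Delta^{2}-8\Delta j-7\Delta+8j, \] and, in the case $2\le j\le\Delta-2$, \[ \sigma(T''')=\Delta^{3}k-2\Delta^{2}k-3\Delta k+6k+4\Delta+j^{3}-j^{2}-6. \]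
   Context: For a graph $G$, $\sigma(G)=\sum_{uv\in E(G)}(d(u)-d(v))^2$, where $d(u)$ is the degree of $u$. For a tree $T$, $n_i$ is the number of vertices of degree $i$, and $m_{ij}=m_{ji}$ is the number of edges whose end-vertices have degrees $i$ and $j$. An internal leaf of a tree is a vertex of degree at least $2$ having precisely one neighbor of degree greater than $1$. A medium vertex is a vertex whose degree lies in $\{3,\ldots,\Delta-1\}$. Let $n=k\Delta+1+j$. The following families consist of trees $T$ on $n$ vertices with maximum degree $\Delta$. $\mathcal{T}'_{n,\Delta}$: all such trees with (1) all internal leaves of $T$ have degree $\Delta$; (2) $m_{22}\le 2$ and $m_{\Delta\Delta}=0$; (3) $\sum_{i=3}^{\Delta-1}n_i\le 1$; (4) $m_{22}=0$ if and only if $\sum_{i=3}^{\Delta-1}n_i=n_a=1$ for some $a\in\{3,\ldots,\Delta-1\}$; (5) if $m_{22}=0$, then $m_{a2}=a$, where $a$ is the degree from (4). $\mathcal{T}''_{n,\Delta}$: all such trees with (1) all internal leaves of $T$ have degree $\Delta$; (2) all vertices have degree in $\{1,2,\Delta\}$; (3) $m_{22}=0$ and $m_{\Delta\Delta}\le\Delta-1$. $\mathcal{T}'''_{n,\Delta}$ (for $2\le j\le\Delta-2$): all such trees with (1) all internal leaves of $T$ have degree $\Delta$; (2) all vertices have degree in $\{1,2,\Delta\}$, except precisely one medium vertex $w$, which has degree $j+1$; (3) $m_{22}=0$; (4) $w$ has precisely $j$ neighbors of degree $2$ and one neighbor of degree $\Delta$; (5) $m_{\Delta\Delta}=0$. 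*)

theory Defs
  imports "Graph_Theory.Pair_Digraph" "Graph_Theory.Digraph_Component"
begin

text \<open>
  A finite simple graph is a \<^locale>\<open>pair_graph\<close>: a finite vertex set with a symmetric irreflexive
  set of arcs, so that each undirected edge is represented by the two arcs \<open>(u, v)\<close> and \<open>(v, u)\<close>.
\<close>

definition neighbors :: "'a pair_pre_digraph \<Rightarrow> 'a \<Rightarrow> 'a set" where
  "neighbors G v = {u. (v, u) \<in> parcs G}"

definition deg :: "'a pair_pre_digraph \<Rightarrow> 'a \<Rightarrow> nat" where
  "deg G v = card (neighbors G v)"

definition edges :: "'a pair_pre_digraph \<Rightarrow> 'a set set" where
  "edges G = {{u, v} |u v. (u, v) \<in> parcs G}"

text \<open>
  The constant \<^const>\<open>tree\<close> of the library is not usable for undirected trees, because it forbids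
  all directed cycles and hence also \<open>u \<rightarrow> v \<rightarrow> u\<close> along a single undirected edge.
  In a \<^locale>\<open>pair_graph\<close> the directed cycles of length at least 3 are exactly the cycles of the
  undirected graph.
\<close>

definition undirected_tree :: "'a pair_pre_digraph \<Rightarrow> bool" where
  "undirected_tree G \<longleftrightarrow> pair_graph G \<and> Digraph_Component.connected (with_proj G) \<and>
     \<not> (\<exists>p. pre_digraph.cycle (with_proj G) p \<and> 3 \<le> length p)"

definition max_degree :: "'a pair_pre_digraph \<Rightarrow> nat" where
  "max_degree G = Max (deg G ` pverts G)"

definition degree_diff_sq :: "'a pair_pre_digraph \<Rightarrow> 'a set \<Rightarrow> int" where
  "degree_diff_sq G e = (THE x. \<exists>u v. e = {u, v} \<and> x = (int (deg G u) - int (deg G v))\<^sup>2)"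

lemma degree_diff_sq_edge [simp]:
  "degree_diff_sq G {u, v} = (int (deg G u) - int (deg G v))\<^sup>2"
  unfolding degree_diff_sq_def
  by (rule the_equality) (auto simp: doubleton_eq_iff power2_commute)

definition sigma_index :: "'a pair_pre_digraph \<Rightarrow> int" where
  "sigma_index G = (\<Sum>e\<in>edges G. degree_diff_sq G e)"

definition n_deg :: "'a pair_pre_digraph \<Rightarrow> nat \<Rightarrow> nat" where
  "n_deg G i = card {v \<in> pverts G. deg G v = i}"

definition m_deg :: "'a pair_pre_digraph \<Rightarrow> nat \<Rightarrow> nat \<Rightarrow> nat" where
  "m_deg G i j = card {e \<in> edges G. \<exists>u v. e = {u, v} \<and> deg G u = i \<and> deg G v = j}"

definition internal_leaf :: "'a pair_pre_digraph \<Rightarrow> 'a \<Rightarrow> bool" where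
  "internal_leaf G v \<longleftrightarrow>
     v \<in> pverts G \<and> 2 \<le> deg G v \<and> card {u \<in> neighbors G v. 1 < deg G u} = 1"

definition medium_vertex :: "'a pair_pre_digraph \<Rightarrow> 'a \<Rightarrow> bool" where
  "medium_vertex G v \<longleftrightarrow> v \<in> pverts G \<and> deg G v \<in> {3..max_degree G - 1}"

definition trees :: "nat \<Rightarrow> nat \<Rightarrow> 'a pair_pre_digraph set" where
  "trees n \<Delta> = {T. undirected_tree T \<and> card (pverts T) = n \<and> max_degree T = \<Delta>}"

definition family1 :: "nat \<Rightarrow> nat \<Rightarrow> 'a pair_pre_digraph set" where
  "family1 n \<Delta> = {T \<in> trees n \<Delta>.
     (\<forall>v. internal_leaf T v \<longrightarrow> deg T v = \<Delta>) \<and>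
     m_deg T 2 2 \<le> 2 \<and> m_deg T \<Delta> \<Delta> = 0 \<and>
     (\<Sum>i=3..\<Delta>-1. n_deg T i) \<le> 1 \<and>
     (m_deg T 2 2 = 0 \<longleftrightarrow>
        (\<exists>a\<in>{3..\<Delta>-1}. (\<Sum>i=3..\<Delta>-1. n_deg T i) = n_deg T a \<and> n_deg T a = 1)) \<and>
     (m_deg T 2 2 = 0 \<longrightarrow>
        (\<forall>a\<in>{3..\<Delta>-1}. (\<Sum>i=3..\<Delta>-1. n_deg T i) = n_deg T a \<and> n_deg T a = 1
           \<longrightarrow> m_deg T a 2 = a))}"

definition family2 :: "nat \<Rightarrow> nat \<Rightarrow> 'a pair_pre_digraph set" where
  "family2 n \<Delta> = {T \<in> trees n \<Delta>.
     (\<forall>v. internal_leaf T v \<longrightarrow> deg T v = \<Delta>) \<and>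
     (\<forall>v\<in>pverts T. deg T v \<in> {1, 2, \<Delta>}) \<and>
     m_deg T 2 2 = 0 \<and> m_deg T \<Delta> \<Delta> \<le> \<Delta> - 1}"

definition family3 :: "nat \<Rightarrow> nat \<Rightarrow> nat \<Rightarrow> 'a pair_pre_digraph set" where
  "family3 n \<Delta> j = {T \<in> trees n \<Delta>.
     (\<forall>v. internal_leaf T v \<longrightarrow> deg T v = \<Delta>) \<and>
     (\<exists>w. medium_vertex T w \<and> deg T w = j + 1 \<and>
        (\<forall>v\<in>pverts T - {w}. deg T v \<in> {1, 2, \<Delta>}) \<and>
        card {u \<in> neighbors T w. deg T u = 2} = j \<and>
        card {u \<in> neighbors T w. deg T u = \<Delta>} = 1) \<and>
     m_deg T 2 2 = 0 \<and>
     m_deg T \<Delta> \<Delta> = 0}"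

end

theory Submission
  imports Defs
begin

text \<open>
  The forbidden internal leaves rule out edges between degrees 1 and 2, so in each family the edges
  join only few pairs of degrees. Counting arcs by the degree of their tail, counting the vertices,
  and the handshake identity for a tree give linear equations for the numbers \<open>n\<^sub>i\<close> and \<open>m\<^sub>i\<^sub>j\<close>, whose
  only free parameter is \<open>n\<^sub>\<Delta>\<close>. Solving them yields \<open>\<Delta> n\<^sub>\<Delta> = k \<Delta> + r\<close> with a remainder \<open>r\<close> built from \<open>j\<close>
  and the exceptional edges. In every family \<open>r\<close> (after shifting it by \<open>\<Delta>\<close> for the second family) has
  absolute value less than \<open>\<Delta>\<close>, so it vanishes; this determines \<open>n\<^sub>\<Delta>\<close> and with it \<open>\<sigma>\<close>.
\<close>

subsection \<open>The number of edges of a tree\<close>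

text \<open>If every vertex had two neighbours in \<open>V\<close>, a simple path could be prolonged
  at its head forever without running into itself, which a finite \<open>V\<close> forbids.\<close>

lemma exists_leaf_if_no_cycle:
  assumes fin: "finite V" and ne: "V \<noteq> {}" and sym: "sym R" and irr: "irrefl R"
    and nocyc: "\<And>cs. \<lbrakk>distinct cs; 3 \<le> length cs; successively (\<lambda>x y. (x, y) \<in> R) cs\<rbrakk>
                  \<Longrightarrow> (last cs, hd cs) \<notin> R"
  shows "\<exists>v\<in>V. card {u \<in> V. (v, u) \<in> R} \<le> 1"
proof (rule ccontr)
  assume "\<not> ?thesis"
  then have two: "2 \<le> card {u \<in> V. (v, u) \<in> R}" if "v \<in> V" for v
    using that by force
  have other: "\<exists>z. z \<in> V \<and> (v, z) \<in> R \<and> z \<noteq> y" if "v \<in> V" for v y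
  proof (rule ccontr)
    assume "\<not> ?thesis"
    then have "{u \<in> V. (v, u) \<in> R} \<subseteq> {y}" by blast
    then have "card {u \<in> V. (v, u) \<in> R} \<le> 1"
      using card_mono[of "{y}"] by simp
    with two[OF that] show False by simp
  qed
  \<comment> \<open>The offset 2 guarantees that the head has a successor on the path, the one
    vertex that the next step must avoid.\<close>
  have paths: "\<exists>cs. length cs = n + 2 \<and> distinct cs \<and> set cs \<subseteq> V
                 \<and> successively (\<lambda>x y. (x, y) \<in> R) cs" for n
  proof (induction n)
    case 0
    from ne obtain v where v: "v \<in> V" by blast
    with other[of v v] obtain z where z: "z \<in> V" "(v, z) \<in> R" "z \<noteq> v" by blast
    with v show ?case by (intro exI[of _ "[v, z]"]) auto
  next
    case (Suc n)
    then obtain cs where cs: "length cs = n + 2" "distinct cs" "set cs \<subseteq> V"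
      "successively (\<lambda>x y. (x, y) \<in> R) cs" by blast
    then obtain x y xs where eq: "cs = x # y # xs"
      by (auto simp: numeral_2_eq_2 length_Suc_conv)
    with cs other[of x y] obtain z where z: "z \<in> V" "(x, z) \<in> R" "z \<noteq> y" by auto
    \<comment> \<open>Otherwise the part of the path up to \<open>z\<close>, closed by the arc back
      to \<open>x\<close>, is a cycle; \<open>z \<noteq> y\<close> gives it at least three
      vertices.\<close>
    have "z \<notin> set cs"
    proof
      assume "z \<in> set cs"
      moreover have "z \<noteq> x" using z irr by (auto simp: irrefl_def)
      ultimately have "z \<in> set xs" using eq z by auto
      then obtain as bs where xs: "xs = as @ z # bs" by (meson split_list)
      define ds where "ds = x # y # as @ [z]"
      have app: "cs = ds @ bs" by (simp add: ds_def eq xs)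
      have "distinct ds" "successively (\<lambda>x y. (x, y) \<in> R) ds"
        using cs by (auto simp: app successively_append_iff)
      moreover have "3 \<le> length ds" by (simp add: ds_def)
      ultimately have "(last ds, hd ds) \<notin> R" using nocyc by blast
      then show False using z sym by (auto simp: ds_def sym_def)
    qed
    then show ?case using cs z sym eq
      by (intro exI[of _ "z # cs"]) (auto simp: sym_def)
  qed
  from paths[of "card V"] obtain cs where "length cs = card V + 2" "distinct cs" "set cs \<subseteq> V"
    by blast
  then show False using card_mono[OF fin, of "set cs"] by (simp add: distinct_card)
qed

text \<open>Induction removes a vertex with at most one neighbour in \<open>V\<close>, which costs
  at most two arcs. Only \<open>V\<close> shrinks; \<open>R\<close> stays fixed, so the absence of
  cycles carries over unchanged.\<close>

lemma card_arcs_le_if_no_cycle: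
  assumes "finite V" and "V \<noteq> {}" and sym: "sym R" and irr: "irrefl R"
    and nocyc: "\<And>cs. \<lbrakk>distinct cs; 3 \<le> length cs; successively (\<lambda>x y. (x, y) \<in> R) cs\<rbrakk>
                  \<Longrightarrow> (last cs, hd cs) \<notin> R"
  shows "card (R \<inter> V \<times> V) \<le> 2 * (card V - 1)"
  using assms(1,2)
proof (induction "card V" arbitrary: V)
  case 0
  then show ?case by simp
next
  case (Suc n)
  have "\<exists>v\<in>V. card {u \<in> V. (v, u) \<in> R} \<le> 1"
    by (rule exists_leaf_if_no_cycle[OF Suc.prems sym irr]) (rule nocyc)
  then obtain v where v: "v \<in> V" and leaf: "card {u \<in> V. (v, u) \<in> R} \<le> 1"
    by blast
  let ?W = "V - {v}" and ?N = "{u \<in> V. (v, u) \<in> R}"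
  have vv: "(v, v) \<notin> R" using irr by (simp add: irrefl_def)
  show ?case
  \<comment> \<open>A single vertex is treated apart because \<open>card ?W - 1\<close> would be
    truncated at 0.\<close>
  proof (cases "?W = {}")
    case True
    then have "V = {v}" using v by blast
    then show ?thesis using vv by auto
  next
    case False
    have IH: "card (R \<inter> ?W \<times> ?W) \<le> 2 * (card ?W - 1)"
      using Suc.hyps(2) Suc.prems(1) False v by (intro Suc.hyps(1)) simp_all
    have W: "card V = Suc (card ?W)" "card ?W \<noteq> 0"
      using card.remove[OF Suc.prems(1) v] Suc.prems(1) False by (simp_all del: Diff_eq_empty_iff)
    have "R \<inter> V \<times> V = R \<inter> ?W \<times> ?W \<union> Pair v ` ?N \<union> (\<lambda>u. (u, v)) ` ?N"
      using v sym by (auto simp: sym_def)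
    then have arcs: "card (R \<inter> V \<times> V) \<le> card (R \<inter> ?W \<times> ?W) + card (Pair v ` ?N)
        + card ((\<lambda>u. (u, v)) ` ?N)"
      by (simp add: order_trans[OF card_Un_le] add_right_mono card_Un_le)
    have N: "card (Pair v ` ?N) \<le> 1" "card ((\<lambda>u. (u, v)) ` ?N) \<le> 1"
      using leaf by (simp_all add: card_image inj_on_def)
    from W(2) obtain w where w: "card ?W = Suc w" by (cases "card ?W") auto
    have "card (R \<inter> V \<times> V) \<le> 2 * w + 1 + 1"
      using IH unfolding w by (intro order_trans[OF arcs] add_mono N) simp
    then show ?thesis unfolding W(1) w by simp
  qed
qed

text \<open>Breadth-first search from a root \<open>r\<close>: every other vertex has a neighbour that is closer to \<open>r\<close>,
  and the arcs between the vertices and these neighbours are pairwise distinct.\<close>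

lemma card_arcs_ge_if_reachable:
  assumes fin: "finite R" and sym: "sym R" and finV: "finite V" and r: "r \<in> V"
    and reach: "\<And>v. v \<in> V \<Longrightarrow> (r, v) \<in> R\<^sup>*"
  shows "2 * (card V - 1) \<le> card R"
proof -
  define d where "d v = (LEAST n. (r, v) \<in> R ^^ n)" for v
  have "\<exists>p. (p, v) \<in> R \<and> d p < d v" if "v \<in> V - {r}" for v
  proof -
    have dv: "(r, v) \<in> R ^^ d v"
    proof -
      have "\<exists>n. (r, v) \<in> R ^^ n" using reach[of v] that by (simp add: rtrancl_power)
      then show ?thesis unfolding d_def by (rule LeastI_ex)
    qed
    moreover have "d v \<noteq> 0"
      using dv that by (cases "d v") auto
    ultimately obtain m p where m: "d v = Suc m" and p: "(r, p) \<in> R ^^ m" "(p, v) \<in> R"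
      by (cases "d v") auto
    have "d p \<le> m" unfolding d_def using p by (auto intro: Least_le)
    then show ?thesis using p m by auto
  qed
  then have "\<exists>p. \<forall>v\<in>V - {r}. (p v, v) \<in> R \<and> d (p v) < d v"
    by (intro bchoice) blast
  then obtain p where p: "\<And>v. v \<in> V - {r} \<Longrightarrow> (p v, v) \<in> R \<and> d (p v) < d v"
    by blast
  let ?A = "(\<lambda>v. (p v, v)) ` (V - {r})" and ?B = "(\<lambda>v. (v, p v)) ` (V - {r})"
  have "?A \<inter> ?B = {}"
  proof (rule equals0I)
    fix e assume "e \<in> ?A \<inter> ?B"
    then obtain v w where vw: "v \<in> V - {r}" "w \<in> V - {r}" "e = (p v, v)" "e = (w, p w)"
      by blast
    then have "p v = w" "p w = v" by auto
    \<comment> \<open>Two vertices that are each other's parent would satisfy both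
      \<open>d w < d v\<close> and \<open>d v < d w\<close>.\<close>
    then show False using p[OF vw(1)] p[OF vw(2)] by simp
  qed
  moreover have "card ?A = card V - 1" "card ?B = card V - 1"
    using finV r by (simp_all add: card_image inj_on_def)
  ultimately have "card (?A \<union> ?B) = 2 * (card V - 1)"
    using finV by (simp add: card_Un_disjoint)
  moreover have "?A \<union> ?B \<subseteq> R"
    using p by (blast intro: symD[OF sym])
  ultimately show ?thesis using card_mono[OF fin, of "?A \<union> ?B"] by simp
qed

text \<open>Zipping a vertex list with its shift yields the arcs of a walk. The end point
  \<open>w\<close> is kept arbitrary for the induction, where the head changes but the end does not;
  \<open>w = hd cs\<close> closes the walk.\<close>

lemma closed_walk_of_vertex_list:
  assumes "cs \<noteq> []"
  shows "pcas (hd cs) (zip cs (tl cs @ [w])) w"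
    and "pawalk_verts (hd cs) (zip cs (tl cs @ [w])) = cs @ [w]"
    and "\<lbrakk>successively (\<lambda>x y. (x, y) \<in> R) cs; (last cs, w) \<in> R\<rbrakk> \<Longrightarrow> set (zip cs (tl cs @ [w])) \<subseteq> R"
  using assms
proof (induction cs)
  case (Cons x cs)
  {
    case 1
    then show ?case using Cons by (cases cs) auto
  next
    case 2
    then show ?case using Cons by (cases cs) auto
  next
    case 3
    then show ?case using Cons by (cases cs) auto
  }
qed auto

section \<open>Reachability, cycles and the arc count of a tree\<close>

locale undirected_tree_graph =
  fixes T :: "'a pair_pre_digraph"
  assumes tree: "undirected_tree T"
begin

sublocale pair_graph T
  using tree by (simp add: undirected_tree_def)

lemma sym_parcs: "sym (parcs T)"
  using pair_sym_arcs by (simp add: symmetric_def)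

lemma parcs_sym: "(u, v) \<in> parcs T \<Longrightarrow> (v, u) \<in> parcs T"
  using sym_parcs by (rule symD)

lemma reachable_parcs: "\<lbrakk>u \<in> pverts T; v \<in> pverts T\<rbrakk> \<Longrightarrow> (u, v) \<in> (parcs T)\<^sup>*"
proof -
  assume uv: "u \<in> pverts T" "v \<in> pverts T"
  \<comment> \<open>Connectedness is defined through the symmetric closure, which adds nothing
    here.\<close>
  have eq: "parcs (mk_symmetric (with_proj T)) = parcs T"
    using parcs_sym by (auto simp: parcs_mk_symmetric)
  moreover have "strongly_connected (with_proj (mk_symmetric (with_proj T)))"
    using tree by (simp add: undirected_tree_def connected_def)
  ultimately have "reachable (with_proj (mk_symmetric (with_proj T))) u v"
    using uv by (simp add: strongly_connected_def)
  then show ?thesis using eq by (metis reachable_rtranclI with_proj_simps(3))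
qed

text \<open>Connectedness in the form used below: a small set that no arc leaves already contains
  the whole tree.\<close>

lemma pverts_subset_if_closed:
  assumes "r \<in> S" and "r \<in> pverts T" and "\<And>u v. \<lbrakk>u \<in> S; (u, v) \<in> parcs T\<rbrakk> \<Longrightarrow> v \<in> S"
  shows "pverts T \<subseteq> S"
proof
  fix v assume "v \<in> pverts T"
  then have "(r, v) \<in> (parcs T)\<^sup>*" using assms reachable_parcs by blast
  then show "v \<in> S" by (induction rule: rtrancl_induct) (use assms in auto)
qed

lemma pverts_nonempty: "pverts T \<noteq> {}"
  using tree by (simp add: undirected_tree_def connected_def strongly_connected_def)

lemma no_vertex_cycle:
  assumes "distinct cs" and "3 \<le> length cs" and "successively (\<lambda>x y. (x, y) \<in> parcs T) cs"
  shows "(last cs, hd cs) \<notin> parcs T"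
proof
  assume arc: "(last cs, hd cs) \<in> parcs T"
  define p where "p = zip cs (tl cs @ [hd cs])"
  have ne: "cs \<noteq> []" using assms by auto
  note walk = closed_walk_of_vertex_list[OF ne, where w = "hd cs", folded p_def]
  \<comment> \<open>The closed walk visits \<open>hd cs\<close> at both ends, so distinctness can
    only be asked of the tail of its vertex list, as \<open>cycle\<close> does.\<close>
  have "distinct (tl (pawalk_verts (hd cs) p))"
    using assms ne unfolding walk(2) by (cases cs) auto
  moreover have "awalk (hd cs) p (hd cs)"
    using walk(1) walk(3)[OF assms(3) arc] in_arcsD2[OF arc] by (simp add: awalk_def)
  moreover have "3 \<le> length p" using assms by (simp add: p_def)
  moreover from this have "p \<noteq> []" by auto
  ultimately have "cycle p" "3 \<le> length p" by (auto simp: cycle_def)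
  then show False using tree by (auto simp: undirected_tree_def)
qed

text \<open>Acyclicity gives the upper bound and connectedness the lower one; the factor 2 counts
  both orientations of each edge.\<close>

lemma card_parcs: "card (parcs T) = 2 * (card (pverts T) - 1)"
proof (rule antisym)
  have "irrefl (parcs T)" using pair_no_loops by (fastforce simp: irrefl_def)
  moreover have "parcs T \<inter> pverts T \<times> pverts T = parcs T" using wellformed' by auto
  ultimately show "card (parcs T) \<le> 2 * (card (pverts T) - 1)"
    using card_arcs_le_if_no_cycle[OF pair_finite_verts pverts_nonempty sym_parcs] no_vertex_cycle
    by metis
  show "2 * (card (pverts T) - 1) \<le> card (parcs T)"
    using card_arcs_ge_if_reachable[OF pair_finite_arcs sym_parcs pair_finite_verts]
      pverts_nonempty reachable_parcs by blast
qed

subsection \<open>Counting vertices and edges by degree\<close>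

text \<open>Arcs are ordered, so this set meets each edge once if \<open>i \<noteq> j\<close> but
  twice if \<open>i = j\<close>. This is the origin of the factors 2 in the linear
  equations.\<close>

definition arcs_between :: "nat \<Rightarrow> nat \<Rightarrow> ('a \<times> 'a) set" where
  "arcs_between i j = {(u, v) \<in> parcs T. deg T u = i \<and> deg T v = j}"

lemma finite_arcs_between [simp]: "finite (arcs_between i j)"
  unfolding arcs_between_def using pair_finite_arcs by (rule rev_finite_subset) auto

lemma edges_eq_image: "edges T = (\<lambda>(u, v). {u, v}) ` parcs T"
  by (auto simp: edges_def)

text \<open>The map from arcs to edges has fibres \<open>{(u, v), (v, u)}\<close>, of size exactly 2
  since there are no loops.\<close>

lemma sum_parcs_eq_twice_sum_edges:
  fixes f :: "'a set \<Rightarrow> 'b::comm_semiring_1"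
  shows "(\<Sum>(u, v)\<in>parcs T. f {u, v}) = 2 * (\<Sum>e\<in>edges T. f e)"
proof -
  let ?h = "\<lambda>(u, v). {u, v}"
  have "(\<Sum>x\<in>{x \<in> parcs T. ?h x = e}. f (?h x)) = 2 * f e" if e: "e \<in> edges T" for e
  proof -
    obtain u v where uv: "(u, v) \<in> parcs T" "e = {u, v}"
      using e by (auto simp: edges_def)
    then have "u \<noteq> v" using no_loops' by blast
    moreover have "{x \<in> parcs T. ?h x = e} = {(u, v), (v, u)}"
      using uv parcs_sym by (auto simp: doubleton_eq_iff)
    ultimately show ?thesis using uv by (simp add: insert_commute mult_2)
  qed
  then have "(\<Sum>e\<in>edges T. \<Sum>x\<in>{x \<in> parcs T. ?h x = e}. f (?h x)) = (\<Sum>e\<in>edges T. 2 * f e)"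
    by (rule sum.cong[OF refl])
  moreover have "(\<Sum>e\<in>edges T. \<Sum>x\<in>{x \<in> parcs T. ?h x = e}. f (?h x)) = (\<Sum>x\<in>parcs T. f (?h x))"
    unfolding edges_eq_image using pair_finite_arcs by (intro sum.group) auto
  ultimately show ?thesis
    by (simp add: sum_distrib_left case_prod_unfold)
qed

lemma twice_sigma_index:
  "2 * sigma_index T = (\<Sum>(u, v)\<in>parcs T. (int (deg T u) - int (deg T v))\<^sup>2)"
  unfolding sigma_index_def sum_parcs_eq_twice_sum_edges[symmetric] by simp

lemma arcs_between_swap: "arcs_between j i = prod.swap ` arcs_between i j"
  using parcs_sym by (force simp: arcs_between_def)

lemma card_arcs_between_commute: "card (arcs_between j i) = card (arcs_between i j)"
  unfolding arcs_between_swap[of j i] by (rule card_image) simp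

lemma m_deg_commute: "m_deg T j i = m_deg T i j"
proof -
  have "(\<exists>u v. e = {u, v} \<and> deg T u = j \<and> deg T v = i) \<longleftrightarrow>
        (\<exists>u v. e = {u, v} \<and> deg T u = i \<and> deg T v = j)" for e
    by (metis insert_commute)
  then show ?thesis by (simp add: m_deg_def)
qed

text \<open>Apply the doubling of sums to the indicator of the edges counted by
  \<open>m_deg\<close>. The union covers both orientations, and its two parts coincide if
  \<open>i = j\<close>.\<close>

lemma twice_m_deg: "2 * m_deg T i j = card (arcs_between i j \<union> arcs_between j i)"
proof -
  let ?P = "\<lambda>e. \<exists>u v. e = {u, v} \<and> deg T u = i \<and> deg T v = j"
  have finE: "finite (edges T)"
    unfolding edges_eq_image using pair_finite_arcs by (rule finite_imageI)
  have "2 * m_deg T i j = 2 * (\<Sum>e\<in>edges T. if ?P e then 1 else 0)"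
    unfolding m_deg_def by (simp add: finE sum.If_cases Int_def)
  also have "\<dots> = (\<Sum>(u, v)\<in>parcs T. if ?P {u, v} then 1 else 0)"
    by (rule sum_parcs_eq_twice_sum_edges[symmetric])
  also have "\<dots> = card {x \<in> parcs T. ?P {fst x, snd x}}"
    using pair_finite_arcs by (simp add: case_prod_unfold sum.If_cases Int_def)
  also have "{x \<in> parcs T. ?P {fst x, snd x}} = arcs_between i j \<union> arcs_between j i"
    by (fastforce simp: arcs_between_def doubleton_eq_iff)
  finally show ?thesis .
qed

lemma card_arcs_between_distinct: "i \<noteq> j \<Longrightarrow> card (arcs_between i j) = m_deg T i j"
proof -
  assume "i \<noteq> j"
  then have "arcs_between i j \<inter> arcs_between j i = {}" by (auto simp: arcs_between_def)
  then show ?thesis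
    using twice_m_deg[of i j] card_arcs_between_commute[of i j] by (simp add: card_Un_disjoint)
qed

lemma card_arcs_between_same: "card (arcs_between i i) = 2 * m_deg T i i"
  using twice_m_deg[of i i] by simp

lemma finite_neighbors [simp]: "finite (neighbors T v)"
  by (rule finite_subset[OF _ pair_finite_verts]) (auto simp: neighbors_def dest: in_arcsD2)

context
  fixes D :: "nat set"
  assumes finD: "finite D" and degs: "deg T ` pverts T \<subseteq> D"
begin

text \<open>Arcs are grouped by the degrees of tail and head. \<open>D\<close> may contain degrees
  that do not occur, since their groups are empty.\<close>

lemma sum_parcs_by_degrees:
  fixes g :: "nat \<Rightarrow> nat \<Rightarrow> 'b::comm_semiring_1"
  shows "(\<Sum>(u, v)\<in>parcs T. g (deg T u) (deg T v)) =
    (\<Sum>i\<in>D. \<Sum>j\<in>D. of_nat (card (arcs_between i j)) * g i j)"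
proof -
  let ?d = "\<lambda>(u, v). (deg T u, deg T v)" and ?g = "\<lambda>(u, v). g (deg T u) (deg T v)"
  have "sum ?g (parcs T) = (\<Sum>y\<in>D \<times> D. sum ?g {x \<in> parcs T. ?d x = y})"
    using pair_finite_arcs finD degs by (intro sum.group[symmetric]) (auto dest: wellformed')
  also have "\<dots> = (\<Sum>(i, j)\<in>D \<times> D. of_nat (card (arcs_between i j)) * g i j)"
  proof (rule sum.cong[OF refl], clarify)
    fix i j
    have "{x \<in> parcs T. ?d x = (i, j)} = arcs_between i j" by (auto simp: arcs_between_def)
    moreover have "sum ?g (arcs_between i j) = (\<Sum>x\<in>arcs_between i j. g i j)"
      by (rule sum.cong) (auto simp: arcs_between_def)
    ultimately show "sum ?g {x \<in> parcs T. ?d x = (i, j)} = of_nat (card (arcs_between i j)) * g i j"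
      by simp
  qed
  also have "\<dots> = (\<Sum>i\<in>D. \<Sum>j\<in>D. of_nat (card (arcs_between i j)) * g i j)"
    by (simp add: sum.cartesian_product)
  finally show ?thesis .
qed

text \<open>Double counting of the arcs with a tail of degree \<open>i\<close>: by tail on the left,
  by the degree of the head on the right.\<close>

lemma degree_times_n_deg: "i * n_deg T i = (\<Sum>j\<in>D. card (arcs_between i j))"
proof -
  let ?V = "{v \<in> pverts T. deg T v = i}" and ?A = "{x \<in> parcs T. deg T (fst x) = i}"
  have "?A = Sigma ?V (neighbors T)" by (auto simp: neighbors_def dest: in_arcsD1)
  then have "card ?A = i * n_deg T i"
    using pair_finite_verts by (simp add: deg_def[symmetric] n_deg_def)
  moreover have "card ?A = (\<Sum>j\<in>D. card {x \<in> ?A. deg T (snd x) = j})"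
    unfolding card_eq_sum
    using pair_finite_arcs finD degs
    by (intro sum.group[symmetric]) (auto simp: image_subset_iff dest: wellformed')
  moreover have "{x \<in> ?A. deg T (snd x) = j} = arcs_between i j" for j
    by (auto simp: arcs_between_def)
  ultimately show ?thesis by simp
qed

lemma card_pverts_by_degrees: "card (pverts T) = (\<Sum>i\<in>D. n_deg T i)"
  unfolding n_deg_def card_eq_sum
  using pair_finite_verts finD degs by (intro sum.group[symmetric]) auto

lemma handshake: "(\<Sum>i\<in>D. i * n_deg T i) = 2 * (card (pverts T) - 1)"
  using sum_parcs_by_degrees[of "\<lambda>_ _. 1::nat"]
  by (simp add: degree_times_n_deg case_prod_unfold card_parcs)

end

section \<open>Edges that cannot occur\<close>

lemma deg_pos: "\<lbrakk>v \<in> pverts T; 2 \<le> card (pverts T)\<rbrakk> \<Longrightarrow> 1 \<le> deg T v"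
proof (rule ccontr)
  assume v: "v \<in> pverts T" "2 \<le> card (pverts T)" "\<not> 1 \<le> deg T v"
  then have "neighbors T v = {}" by (simp add: deg_def not_less_eq_eq)
  then have "pverts T \<subseteq> {v}"
    using v by (intro pverts_subset_if_closed) (auto simp: neighbors_def)
  then show False using v card_mono[of "{v}" "pverts T"] by simp
qed

lemma neighbors_deg_1: "\<lbrakk>deg T u = 1; (u, v) \<in> parcs T\<rbrakk> \<Longrightarrow> neighbors T u = {v}"
  unfolding deg_def by (metis card_1_singletonE mem_Collect_eq neighbors_def singletonD)

text \<open>Two adjacent vertices of degree 1 would be the whole tree.\<close>

lemma m_deg_1_1:
  assumes "3 \<le> card (pverts T)"
  shows "m_deg T 1 1 = 0"
proof -
  have False if uv: "(u, v) \<in> parcs T" "deg T u = 1" "deg T v = 1" for u v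
  proof -
    have "neighbors T u = {v}" "neighbors T v = {u}"
      using uv neighbors_deg_1 parcs_sym by blast+
    then have "pverts T \<subseteq> {u, v}"
      using uv by (intro pverts_subset_if_closed[of u]) (auto simp: neighbors_def dest: in_arcsD1)
    then show False
      using assms card_mono[of "{u, v}" "pverts T"] card_insert_le_m1[of 2 "{v}" u] by simp
  qed
  then have "arcs_between 1 1 = {}" by (auto simp: arcs_between_def)
  then show ?thesis using card_arcs_between_same[of 1] by simp
qed

text \<open>Let \<open>x\<close> be the other neighbour of the vertex of degree 2. If
  \<open>x\<close> has degree 1, the tree is a path on three vertices; otherwise the vertex of
  degree 2 is a forbidden internal leaf.\<close>

lemma m_deg_1_2:
  assumes n: "4 \<le> card (pverts T)" and leaf: "\<And>v. internal_leaf T v \<Longrightarrow> deg T v \<noteq> 2"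
  shows "m_deg T 1 2 = 0"
proof -
  have False if uv: "(u, v) \<in> parcs T" "deg T u = 1" "deg T v = 2" for u v
  proof -
    have Nu: "neighbors T u = {v}" using uv neighbors_deg_1 by blast
    have "u \<in> neighbors T v" using uv parcs_sym by (simp add: neighbors_def)
    moreover have "card (neighbors T v) = 2" using uv by (simp add: deg_def)
    ultimately obtain x where Nv: "neighbors T v = {u, x}" "x \<noteq> u"
      by (metis card_2_iff doubleton_eq_iff insertE singletonD)
    have vx: "(v, x) \<in> parcs T" using Nv by (auto simp: neighbors_def)
    have "deg T x \<noteq> 1"
    proof
      assume "deg T x = 1"
      then have "neighbors T x = {v}" using vx neighbors_deg_1 parcs_sym by blast
      then have "pverts T \<subseteq> {u, v, x}"
        using uv Nu Nv by (intro pverts_subset_if_closed[of u]) (auto simp: neighbors_def dest: in_arcsD1)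
      then have "card (pverts T) \<le> card {u, v, x}" by (intro card_mono) auto
      also have "\<dots> \<le> 3" by (simp add: card_insert_if)
      finally show False using n by simp
    qed
    moreover have "1 \<le> deg T x" using deg_pos[of x] vx n by (auto dest: in_arcsD2)
    ultimately have "{w \<in> neighbors T v. 1 < deg T w} = {x}" using Nv uv by auto
    then have "internal_leaf T v"
      using uv by (auto simp: internal_leaf_def dest: in_arcsD2)
    then show False using leaf uv by blast
  qed
  then have "arcs_between 1 2 = {}" by (auto simp: arcs_between_def)
  then show ?thesis using card_arcs_between_distinct[of 1 2] by simp
qed

section \<open>Linear equations for the degree counts, and their solution\<close>

lemma degree_counts:
  assumes a: "2 < a" "a < \<Delta>" and degs: "deg T ` pverts T \<subseteq> {1, 2, a, \<Delta>}"
    and m11: "m_deg T 1 1 = 0" and m12: "m_deg T 1 2 = 0"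
  shows "n_deg T 1 = m_deg T 1 a + m_deg T 1 \<Delta>"
    and "2 * n_deg T 2 = 2 * m_deg T 2 2 + m_deg T a 2 + m_deg T 2 \<Delta>"
    and "a * n_deg T a = m_deg T 1 a + m_deg T a 2 + 2 * m_deg T a a + m_deg T a \<Delta>"
    and "\<Delta> * n_deg T \<Delta> = m_deg T 1 \<Delta> + m_deg T 2 \<Delta> + m_deg T a \<Delta> + 2 * m_deg T \<Delta> \<Delta>"
    and "card (pverts T) = n_deg T 1 + n_deg T 2 + n_deg T a + n_deg T \<Delta>"
    and "n_deg T 1 + 2 * n_deg T 2 + a * n_deg T a + \<Delta> * n_deg T \<Delta> = 2 * (card (pverts T) - 1)"
    and "sigma_index T = int (m_deg T 1 a) * (int a - 1)\<^sup>2 + int (m_deg T 1 \<Delta>) * (int \<Delta> - 1)\<^sup>2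
      + int (m_deg T a 2) * (int a - 2)\<^sup>2 + int (m_deg T 2 \<Delta>) * (int \<Delta> - 2)\<^sup>2
      + int (m_deg T a \<Delta>) * (int \<Delta> - int a)\<^sup>2"
proof -
  let ?D = "{1, 2, a, \<Delta>}"
  have fin: "finite ?D" by simp
  have ne: "a \<noteq> 1" "a \<noteq> 2" "\<Delta> \<noteq> 1" "\<Delta> \<noteq> 2" "a \<noteq> \<Delta>" "1 \<noteq> a" "2 \<noteq> a" "1 \<noteq> \<Delta>" "2 \<noteq> \<Delta>" "\<Delta> \<noteq> a"
    using a by auto
  have sumD: "sum f ?D = f 1 + f 2 + f a + f \<Delta>" for f :: "nat \<Rightarrow> 'b::comm_monoid_add"
    using ne by (simp add: add.assoc)
  \<comment> \<open>One fixed orientation for each pair of degrees, so that equal counts become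
    syntactically equal.\<close>
  note comm = m_deg_commute[of 2 1] m_deg_commute[of a 1] m_deg_commute[of \<Delta> 1]
    m_deg_commute[of 2 a] m_deg_commute[of \<Delta> 2] m_deg_commute[of \<Delta> a]
  have ones: "(1::nat) \<noteq> 2" "(2::nat) \<noteq> 1" by simp_all
  note arcs = card_arcs_between_same card_arcs_between_distinct[OF ones(1)]
    card_arcs_between_distinct[OF ones(2)] ne[THEN card_arcs_between_distinct]
  note row = degree_times_n_deg[OF fin degs, unfolded sumD]
  show "n_deg T 1 = m_deg T 1 a + m_deg T 1 \<Delta>"
    using row[of 1] m11 m12 by (simp only: arcs comm)
  show "2 * n_deg T 2 = 2 * m_deg T 2 2 + m_deg T a 2 + m_deg T 2 \<Delta>"
    using row[of 2] m12 by (simp only: arcs comm)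
  show "a * n_deg T a = m_deg T 1 a + m_deg T a 2 + 2 * m_deg T a a + m_deg T a \<Delta>"
    using row[of a] by (simp only: arcs comm)
  show "\<Delta> * n_deg T \<Delta> = m_deg T 1 \<Delta> + m_deg T 2 \<Delta> + m_deg T a \<Delta> + 2 * m_deg T \<Delta> \<Delta>"
    using row[of \<Delta>] by (simp only: arcs comm)
  show "card (pverts T) = n_deg T 1 + n_deg T 2 + n_deg T a + n_deg T \<Delta>"
    using card_pverts_by_degrees[OF fin degs] by (simp only: sumD)
  show "n_deg T 1 + 2 * n_deg T 2 + a * n_deg T a + \<Delta> * n_deg T \<Delta> = 2 * (card (pverts T) - 1)"
    using handshake[OF fin degs] by (simp only: sumD)
  have "2 * sigma_index T = 2 * (int (m_deg T 1 a) * (int a - 1)\<^sup>2 + int (m_deg T 1 \<Delta>) * (int \<Delta> - 1)\<^sup>2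
      + int (m_deg T a 2) * (int a - 2)\<^sup>2 + int (m_deg T 2 \<Delta>) * (int \<Delta> - 2)\<^sup>2
      + int (m_deg T a \<Delta>) * (int \<Delta> - int a)\<^sup>2)"
    unfolding twice_sigma_index sum_parcs_by_degrees[OF fin degs, of "\<lambda>i j. (int i - int j)\<^sup>2"] sumD
      arcs comm m11 m12
    by (simp add: power2_eq_square algebra_simps)
  then show "sigma_index T = int (m_deg T 1 a) * (int a - 1)\<^sup>2 + int (m_deg T 1 \<Delta>) * (int \<Delta> - 1)\<^sup>2
      + int (m_deg T a 2) * (int a - 2)\<^sup>2 + int (m_deg T 2 \<Delta>) * (int \<Delta> - 2)\<^sup>2
      + int (m_deg T a \<Delta>) * (int \<Delta> - int a)\<^sup>2"
    by simp
qed


text \<open>A medium vertex need not exist: if \<open>n\<^sub>a = 0\<close>, then any \<open>a\<close> strictly between 2 and \<open>\<Delta>\<close> may be chosen.\<close>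

lemma sigma_index_formula:
  assumes a: "2 < a" "a < \<Delta>" and degs: "deg T ` pverts T \<subseteq> {1, 2, a, \<Delta>}"
    and n: "4 \<le> card (pverts T)" and leaf: "\<forall>v. internal_leaf T v \<longrightarrow> deg T v = \<Delta>"
    and na_le: "a * n_deg T a \<le> m_deg T a 2 + m_deg T a \<Delta>"
  defines "A \<equiv> int (n_deg T a)" and "X \<equiv> int (n_deg T \<Delta>)" and "q \<equiv> int (m_deg T a \<Delta>)"
    and "p \<equiv> int (m_deg T a 2)" and "C \<equiv> int (m_deg T \<Delta> \<Delta>)" and "d \<equiv> int \<Delta>"
  shows "sigma_index T = (2 + (d - 2) * X + (int a - 2) * A) * (d - 1)\<^sup>2 + p * (int a - 2)\<^sup>2
      + (2 * X - 2 - (int a - 2) * A - q - 2 * C) * (d - 2)\<^sup>2 + q * (d - int a)\<^sup>2"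
    and "d * X = int (card (pverts T)) - 1 - int (m_deg T 2 2) - p + C"
    and "a * n_deg T a = m_deg T a 2 + m_deg T a \<Delta>"
proof -
  have m11: "m_deg T 1 1 = 0" using n by (intro m_deg_1_1) simp
  have m12: "m_deg T 1 2 = 0" using n leaf a by (intro m_deg_1_2) force+
  note counts = degree_counts[OF a degs m11 m12]
  \<comment> \<open>The assumed inequality leaves no room in the row of \<open>a\<close> for edges
    to degree 1 or between two vertices of degree \<open>a\<close>.\<close>
  from counts(3) na_le have m1a: "m_deg T 1 a = 0" by simp
  from counts(3) na_le show na: "a * n_deg T a = m_deg T a 2 + m_deg T a \<Delta>" by simp
  have r1: "int (n_deg T 1) = int (m_deg T 1 \<Delta>)"
    using counts(1) m1a by simp
  have r2: "2 * int (n_deg T 2) = 2 * int (m_deg T 2 2) + p + int (m_deg T 2 \<Delta>)"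
    using counts(2) unfolding p_def by presburger
  have ra: "int a * A = p + q"
    using arg_cong[OF na, of int] by (simp add: A_def p_def q_def)
  have rX: "d * X = int (m_deg T 1 \<Delta>) + int (m_deg T 2 \<Delta>) + q + 2 * C"
    using arg_cong[OF counts(4), of int] by (simp add: d_def X_def q_def C_def)
  have V: "int (card (pverts T)) = int (n_deg T 1) + int (n_deg T 2) + A + X"
    using arg_cong[OF counts(5), of int] by (simp add: A_def X_def)
  have H: "int (n_deg T 1) + 2 * int (n_deg T 2) + int a * A + d * X = 2 * (int (card (pverts T)) - 1)"
    using arg_cong[OF counts(6), of int] n by (simp add: A_def X_def d_def of_nat_diff)
  \<comment> \<open>Subtracting twice \<open>V\<close> from \<open>H\<close> eliminates
    \<open>n_deg T 2\<close>.\<close>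
  have e1: "int (m_deg T 1 \<Delta>) = 2 + (d - 2) * X + (int a - 2) * A"
    using r1 V H by (simp add: left_diff_distrib)
  have e2: "int (m_deg T 2 \<Delta>) = 2 * X - 2 - (int a - 2) * A - q - 2 * C"
    using rX e1 by (simp add: left_diff_distrib)
  show "sigma_index T = (2 + (d - 2) * X + (int a - 2) * A) * (d - 1)\<^sup>2 + p * (int a - 2)\<^sup>2
      + (2 * X - 2 - (int a - 2) * A - q - 2 * C) * (d - 2)\<^sup>2 + q * (d - int a)\<^sup>2"
    unfolding counts(7) m1a e1 e2 d_def[symmetric] p_def[symmetric] q_def[symmetric] by simp
  show "d * X = int (card (pverts T)) - 1 - int (m_deg T 2 2) - p + C"
  proof -
    \<comment> \<open>With the products \<open>int a * A\<close> and \<open>d * X\<close> replaced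
      by variables, the system is linear; combining the equations gives twice the claim.\<close>
    have "n1 + 2 * n2 + aA + dX = 2 * (N - 1) \<Longrightarrow> n1 = m1 \<Longrightarrow> 2 * n2 = 2 * B + p + m2 \<Longrightarrow> aA = p + q
      \<Longrightarrow> dX = m1 + m2 + q + 2 * C \<Longrightarrow> dX = N - 1 - B - p + C"
      for n1 n2 aA dX N m1 m2 B p q C :: int by presburger
    then show ?thesis using r1 r2 ra rX H by blast
  qed
qed

section \<open>Counts for absent degrees and for a degree attained once\<close>

lemma deg_le_max_degree: "v \<in> pverts T \<Longrightarrow> deg T v \<le> max_degree T"
  unfolding max_degree_def using pair_finite_verts by (intro Max_ge) auto

lemma n_deg_pos: "v \<in> pverts T \<Longrightarrow> 1 \<le> n_deg T (deg T v)"
  unfolding n_deg_def using pair_finite_verts by (auto simp: Suc_le_eq card_gt_0_iff)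

lemma n_deg_eq_0: "\<lbrakk>deg T ` pverts T \<subseteq> D; i \<notin> D\<rbrakk> \<Longrightarrow> n_deg T i = 0"
  unfolding n_deg_def by (auto simp: card_eq_0_iff)

lemma m_deg_eq_0_if_n_deg_eq_0: "\<lbrakk>n_deg T i = 0; i \<noteq> j\<rbrakk> \<Longrightarrow> m_deg T i j = 0"
proof -
  assume n: "n_deg T i = 0" and "i \<noteq> j"
  have "{v \<in> pverts T. deg T v = i} = {}"
    using n pair_finite_verts by (simp add: n_deg_def)
  then have "arcs_between i j = {}" by (auto simp: arcs_between_def dest: in_arcsD1)
  then show ?thesis using card_arcs_between_distinct[OF \<open>i \<noteq> j\<close>] by simp
qed

text \<open>All arcs with a tail of degree \<open>i\<close> start at \<open>w\<close>, so a global
  edge count becomes a count among the neighbours of \<open>w\<close>.\<close>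

lemma m_deg_of_unique:
  assumes w: "w \<in> pverts T" "deg T w = i" and unique: "\<And>v. \<lbrakk>v \<in> pverts T; deg T v = i\<rbrakk> \<Longrightarrow> v = w"
    and "i \<noteq> j"
  shows "n_deg T i = 1" and "m_deg T i j = card {u \<in> neighbors T w. deg T u = j}"
proof -
  have "{v \<in> pverts T. deg T v = i} = {w}" using w unique by blast
  then show "n_deg T i = 1" by (simp add: n_deg_def)
  have "arcs_between i j = Pair w ` {u \<in> neighbors T w. deg T u = j}"
  proof -
    have "x = w" if "(x, y) \<in> parcs T" "deg T x = i" for x y
      using unique in_arcsD1[OF that(1)] that(2) by blast
    then show ?thesis using w by (fastforce simp: arcs_between_def neighbors_def)
  qed
  then show "m_deg T i j = card {u \<in> neighbors T w. deg T u = j}"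
    using card_arcs_between_distinct[OF \<open>i \<noteq> j\<close>] by (simp add: card_image inj_on_def)
qed

end

subsection \<open>The three families\<close>

text \<open>\<open>r\<close> is a multiple of \<open>d\<close> of smaller absolute value, hence
  0.\<close>

lemma eq_if_int_mult_near:
  fixes d x k r :: int
  assumes "d * x = k * d + r" and "\<bar>r\<bar> < d"
  shows "x = k \<and> r = 0"
proof -
  have "d * (x - k) = r" using assms by (simp add: algebra_simps)
  then have "d dvd r" by (metis dvd_triv_left)
  then have "r = 0" using assms(2) zdvd_not_zless[of "\<bar>r\<bar>" d] by auto
  then show ?thesis using assms by simp
qed

lemma undirected_tree_graph_if_trees: "T \<in> trees n \<Delta> \<Longrightarrow> undirected_tree_graph T"
  by unfold_locales (simp add: trees_def)

text \<open>If a medium vertex exists, the vanishing remainder identifies its degree as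
  \<open>j\<close>, so \<open>j \<ge> 3\<close>. If none exists, it gives
  \<open>m_deg T 2 2 = j\<close>, so \<open>j \<le> 2\<close>. Both times
  \<open>n_deg T \<Delta> = k\<close>.\<close>

lemma sigma_index_family1:
  assumes \<Delta>: "6 \<le> \<Delta>" and n: "n = k * \<Delta> + 1 + j" and k: "1 \<le> k" and j: "1 \<le> j" "j \<le> \<Delta> - 1"
    and T: "T \<in> family1 n \<Delta>"
  shows "sigma_index T =
    (if j \<le> 2
     then int \<Delta> ^ 3 * int k - 2 * int \<Delta> ^ 2 * int k - 3 * int \<Delta> * int k + 6 * int k
            + 4 * int \<Delta> - 6
     else int \<Delta> ^ 3 * int k - 2 * int \<Delta> ^ 2 * int k - 3 * int \<Delta> * int k + 6 * int k
            + 2 * int \<Delta> * int j + int j ^ 3 - 4 * int j ^ 2 + int j)"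
proof -
  have T': "T \<in> trees n \<Delta>" and leaf: "\<forall>v. internal_leaf T v \<longrightarrow> deg T v = \<Delta>"
    and m22: "m_deg T 2 2 \<le> 2" and mDD: "m_deg T \<Delta> \<Delta> = 0"
    and medium: "(\<Sum>i=3..\<Delta>-1. n_deg T i) \<le> 1"
    and m22_iff: "m_deg T 2 2 = 0 \<longleftrightarrow>
        (\<exists>a\<in>{3..\<Delta>-1}. (\<Sum>i=3..\<Delta>-1. n_deg T i) = n_deg T a \<and> n_deg T a = 1)"
    and m22_0: "\<And>a. \<lbrakk>m_deg T 2 2 = 0; a\<in>{3..\<Delta>-1}; (\<Sum>i=3..\<Delta>-1. n_deg T i) = n_deg T a; n_deg T a = 1\<rbrakk>
        \<Longrightarrow> m_deg T a 2 = a"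
    using T by (auto simp: family1_def)
  interpret undirected_tree_graph T using T' by (rule undirected_tree_graph_if_trees)
  have card: "card (pverts T) = n" and max: "max_degree T = \<Delta>" using T' by (simp_all add: trees_def)
  have "1 * 6 \<le> k * \<Delta>" using k \<Delta> by (intro mult_le_mono)
  then have n4: "4 \<le> card (pverts T)" using n card by linarith
  have single: "n_deg T i + n_deg T i' \<le> 1" if "i \<in> {3..\<Delta>-1}" "i' \<in> {3..\<Delta>-1}" "i \<noteq> i'" for i i'
  proof -
    have "n_deg T i + n_deg T i' = sum (n_deg T) {i, i'}" using that by simp
    also have "\<dots> \<le> (\<Sum>i=3..\<Delta>-1. n_deg T i)" using that by (intro sum_mono2) auto
    finally show ?thesis using medium by simp
  qed
  have range: "deg T v \<in> {1, 2, \<Delta>} \<union> {3..\<Delta>-1}" if "v \<in> pverts T" for v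
    using deg_pos[OF that] deg_le_max_degree[OF that] n4 max by auto
  have medium_pos: "1 \<le> (\<Sum>i=3..\<Delta>-1. n_deg T i)" if "v \<in> pverts T" "deg T v \<in> {3..\<Delta>-1}" for v
    using n_deg_pos[OF that(1)] member_le_sum[OF that(2), of "n_deg T"] by simp
  show ?thesis
  proof (cases "m_deg T 2 2 = 0")
    case True
    with m22_iff obtain a where a: "a \<in> {3..\<Delta>-1}" "(\<Sum>i=3..\<Delta>-1. n_deg T i) = n_deg T a" "n_deg T a = 1"
      by blast
    have ma2: "m_deg T a 2 = a" using m22_0[OF True a] .
    have degs: "deg T ` pverts T \<subseteq> {1, 2, a, \<Delta>}"
    proof (rule image_subsetI)
      fix v assume v: "v \<in> pverts T"
      \<comment> \<open>A second medium degree would raise the sum of the medium counts above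
        1.\<close>
      have "deg T v = a" if "deg T v \<in> {3..\<Delta>-1}"
        using single[OF that a(1)] a(3) n_deg_pos[OF v] by fastforce
      then show "deg T v \<in> {1, 2, a, \<Delta>}" using range[OF v] by blast
    qed
    have na: "a * n_deg T a \<le> m_deg T a 2 + m_deg T a \<Delta>" using a(3) ma2 by simp
    have a': "2 < a" "a < \<Delta>" using a(1) \<Delta> by auto
    note formula = sigma_index_formula[OF a' degs n4 leaf na]
    have maD: "m_deg T a \<Delta> = 0" using formula(3) a(3) ma2 by simp
    have "int \<Delta> * int (n_deg T \<Delta>) = int k * int \<Delta> + (int j - int a)"
      using formula(2) by (simp add: card n True ma2 mDD)
    moreover have "\<bar>int j - int a\<bar> < int \<Delta>" using a' j by linarith
    ultimately have "int (n_deg T \<Delta>) = int k \<and> int j - int a = 0" by (rule eq_if_int_mult_near)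
    then have X: "n_deg T \<Delta> = k" and "a = j" by auto
    have "\<not> j \<le> 2" using a' \<open>a = j\<close> by simp
    then show ?thesis
      unfolding formula(1) X ma2 maD mDD a(3)
      by (simp add: \<open>a = j\<close> algebra_simps power2_eq_square power3_eq_cube)
  next
    case False
    have "(\<Sum>i=3..\<Delta>-1. n_deg T i) = 0"
    proof (rule ccontr)
      assume nz: "(\<Sum>i=3..\<Delta>-1. n_deg T i) \<noteq> 0"
      then obtain a where a: "a \<in> {3..\<Delta>-1}" "n_deg T a \<noteq> 0" by (meson sum.neutral)
      with member_le_sum[OF a(1), of "n_deg T"] medium
      have "(\<Sum>i=3..\<Delta>-1. n_deg T i) = n_deg T a \<and> n_deg T a = 1" by simp
      then have "\<exists>a\<in>{3..\<Delta>-1}. (\<Sum>i=3..\<Delta>-1. n_deg T i) = n_deg T a \<and> n_deg T a = 1"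
        using a(1) by (rule bexI)
      then show False using m22_iff False by simp
    qed
    then have degs': "deg T ` pverts T \<subseteq> {1, 2, \<Delta>}" using range medium_pos by fastforce
    \<comment> \<open>No medium vertex exists, so 3 serves as a placeholder for \<open>a\<close>;
      its counts vanish.\<close>
    then have degs: "deg T ` pverts T \<subseteq> {1, 2, 3, \<Delta>}" by blast
    have n3: "n_deg T 3 = 0" using degs' \<Delta> by (intro n_deg_eq_0) auto
    have m3: "m_deg T 3 2 = 0" "m_deg T 3 \<Delta> = 0"
      using n3 \<Delta> by (simp_all add: m_deg_eq_0_if_n_deg_eq_0)
    have a': "(2::nat) < 3" "3 < \<Delta>" using \<Delta> by simp_all
    note formula = sigma_index_formula[OF a' degs n4 leaf, unfolded n3 m3, simplified]
    have "int \<Delta> * int (n_deg T \<Delta>) = int k * int \<Delta> + (int j - int (m_deg T 2 2))"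
      using formula(2) by (simp add: card n mDD)
    moreover have "\<bar>int j - int (m_deg T 2 2)\<bar> < int \<Delta>" using m22 j \<Delta> by linarith
    ultimately have "int (n_deg T \<Delta>) = int k \<and> int j - int (m_deg T 2 2) = 0" by (rule eq_if_int_mult_near)
    then have X: "n_deg T \<Delta> = k" and "j \<le> 2" using m22 by auto
    then show ?thesis
      unfolding formula(1) X mDD
      by (simp add: algebra_simps power2_eq_square power3_eq_cube)
  qed
qed

lemma sigma_index_family2:
  assumes \<Delta>: "6 \<le> \<Delta>" and n: "n = k * \<Delta> + 1 + j" and k: "1 \<le> k" and j: "1 \<le> j" "j \<le> \<Delta> - 1"
    and T: "T \<in> family2 n \<Delta>"
  shows "sigma_index T =
    int \<Delta> ^ 3 * int k - 2 * int \<Delta> ^ 2 * int k - 3 * int \<Delta> * int k + 6 * int k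
      - int \<Delta> ^ 3 + 2 * int \<Delta> ^ 2 * int j + 6 * int \<Delta> ^ 2 - 8 * int \<Delta> * int j
      - 7 * int \<Delta> + 8 * int j"
proof -
  have T': "T \<in> trees n \<Delta>" and leaf: "\<forall>v. internal_leaf T v \<longrightarrow> deg T v = \<Delta>"
    and degs': "deg T ` pverts T \<subseteq> {1, 2, \<Delta>}"
    and m22: "m_deg T 2 2 = 0" and mDD: "m_deg T \<Delta> \<Delta> \<le> \<Delta> - 1"
    using T by (auto simp: family2_def)
  interpret undirected_tree_graph T using T' by (rule undirected_tree_graph_if_trees)
  have card: "card (pverts T) = n" using T' by (simp add: trees_def)
  have "1 * 6 \<le> k * \<Delta>" using k \<Delta> by (intro mult_le_mono)
  then have n4: "4 \<le> card (pverts T)" using n card by linarith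
  have degs: "deg T ` pverts T \<subseteq> {1, 2, 3, \<Delta>}" using degs' by blast
  have n3: "n_deg T 3 = 0" using degs' \<Delta> by (intro n_deg_eq_0) auto
  have m3: "m_deg T 3 2 = 0" "m_deg T 3 \<Delta> = 0"
    using n3 \<Delta> by (simp_all add: m_deg_eq_0_if_n_deg_eq_0)
  have a: "(2::nat) < 3" "3 < \<Delta>" using \<Delta> by simp_all
  note formula = sigma_index_formula[OF a degs n4 leaf, unfolded n3 m3, simplified]
  \<comment> \<open>The sum \<open>j + m_deg T \<Delta> \<Delta>\<close> lies between 1 and
    \<open>2 * \<Delta> - 2\<close>, where \<open>\<Delta>\<close> is the only multiple of
    \<open>\<Delta>\<close>; hence \<open>k + 1\<close> in place of \<open>k\<close>.\<close>
  have "int \<Delta> * int (n_deg T \<Delta>) = int (k + 1) * int \<Delta> + (int j + int (m_deg T \<Delta> \<Delta>) - int \<Delta>)"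
    using formula(2) by (simp add: card n m22 algebra_simps)
  moreover have "\<bar>int j + int (m_deg T \<Delta> \<Delta>) - int \<Delta>\<bar> < int \<Delta>" using mDD j \<Delta> by linarith
  ultimately have "int (n_deg T \<Delta>) = int (k + 1) \<and> int j + int (m_deg T \<Delta> \<Delta>) - int \<Delta> = 0"
    by (rule eq_if_int_mult_near)
  then have X: "int (n_deg T \<Delta>) = int k + 1" and C: "int (m_deg T \<Delta> \<Delta>) = int \<Delta> - int j" by auto
  show ?thesis
    unfolding formula(1) X C
    by (simp add: algebra_simps power2_eq_square power3_eq_cube)
qed

lemma sigma_index_family3:
  assumes \<Delta>: "6 \<le> \<Delta>" and n: "n = k * \<Delta> + 1 + j" and k: "1 \<le> k" and j: "2 \<le> j" "j \<le> \<Delta> - 2"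
    and T: "T \<in> family3 n \<Delta> j"
  shows "sigma_index T =
    int \<Delta> ^ 3 * int k - 2 * int \<Delta> ^ 2 * int k - 3 * int \<Delta> * int k + 6 * int k
      + 4 * int \<Delta> + int j ^ 3 - int j ^ 2 - 6"
proof -
  from T obtain w where T': "T \<in> trees n \<Delta>" and leaf: "\<forall>v. internal_leaf T v \<longrightarrow> deg T v = \<Delta>"
    and w: "w \<in> pverts T" "deg T w = j + 1"
    and others: "\<forall>v\<in>pverts T - {w}. deg T v \<in> {1, 2, \<Delta>}"
    and nbrs: "card {u \<in> neighbors T w. deg T u = 2} = j"
      "card {u \<in> neighbors T w. deg T u = \<Delta>} = 1"
    and m22: "m_deg T 2 2 = 0" and mDD: "m_deg T \<Delta> \<Delta> = 0"
    unfolding family3_def medium_vertex_def by blast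
  interpret undirected_tree_graph T using T' by (rule undirected_tree_graph_if_trees)
  have card: "card (pverts T) = n" using T' by (simp add: trees_def)
  have "1 * 6 \<le> k * \<Delta>" using k \<Delta> by (intro mult_le_mono)
  then have n4: "4 \<le> card (pverts T)" using n card by linarith
  have a: "2 < j + 1" "j + 1 < \<Delta>" using j \<Delta> by auto
  have degs: "deg T ` pverts T \<subseteq> {1, 2, j + 1, \<Delta>}" using w others by blast
  have unique: "v = w" if "v \<in> pverts T" "deg T v = j + 1" for v
    using others a that by force
  have na: "n_deg T (j + 1) = 1"
    by (rule m_deg_of_unique(1)[OF w unique, of \<Delta>]) (use a in auto)
  have ma: "m_deg T (j + 1) 2 = j" "m_deg T (j + 1) \<Delta> = 1"
    using m_deg_of_unique(2)[OF w unique, of 2] m_deg_of_unique(2)[OF w unique, of \<Delta>] nbrs a by auto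
  \<comment> \<open>The \<open>j\<close> neighbours of degree 2 and the one of degree
    \<open>\<Delta>\<close> exhaust the degree of \<open>w\<close>, so equality holds.\<close>
  have "(j + 1) * n_deg T (j + 1) \<le> m_deg T (j + 1) 2 + m_deg T (j + 1) \<Delta>"
    unfolding na ma by simp
  note formula = sigma_index_formula[OF a degs n4 leaf this]
  \<comment> \<open>The \<open>j\<close> edges from \<open>w\<close> to degree 2 cancel the
    \<open>j\<close> in \<open>n\<close>, so the remainder is 0 from the start.\<close>
  have "int \<Delta> * int (n_deg T \<Delta>) = int k * int \<Delta> + 0"
    using formula(2) unfolding card n m22 ma mDD by simp
  then have "int (n_deg T \<Delta>) = int k \<and> (0::int) = 0"
    by (rule eq_if_int_mult_near) (use \<Delta> in simp)
  then have X: "n_deg T \<Delta> = k" by simp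
  show ?thesis
    unfolding formula(1) X na ma mDD
    by (simp add: algebra_simps power2_eq_square power3_eq_cube)
qed

theorem corollary9:
  fixes \<Delta> n k j :: nat
    and T1 :: "'a pair_pre_digraph" and T2 :: "'b pair_pre_digraph" and T3 :: "'c pair_pre_digraph"
  assumes "\<Delta> \<ge> 6" and "n = k * \<Delta> + 1 + j" and "k \<ge> \<Delta> - 1" and "1 \<le> j" and "j \<le> \<Delta> - 1"
  shows
    "(T1 \<in> family1 n \<Delta> \<longrightarrow>
        sigma_index T1 =
          (if j \<le> 2
           then int \<Delta> ^ 3 * int k - 2 * int \<Delta> ^ 2 * int k - 3 * int \<Delta> * int k + 6 * int k
                  + 4 * int \<Delta> - 6
           else int \<Delta> ^ 3 * int k - 2 * int \<Delta> ^ 2 * int k - 3 * int \<Delta> * int k + 6 * int k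
                  + 2 * int \<Delta> * int j + int j ^ 3 - 4 * int j ^ 2 + int j)) \<and>
     (T2 \<in> family2 n \<Delta> \<longrightarrow>
        sigma_index T2 =
          int \<Delta> ^ 3 * int k - 2 * int \<Delta> ^ 2 * int k - 3 * int \<Delta> * int k + 6 * int k
            - int \<Delta> ^ 3 + 2 * int \<Delta> ^ 2 * int j + 6 * int \<Delta> ^ 2 - 8 * int \<Delta> * int j
            - 7 * int \<Delta> + 8 * int j) \<and>
     (2 \<le> j \<and> j \<le> \<Delta> - 2 \<and> T3 \<in> family3 n \<Delta> j \<longrightarrow>
        sigma_index T3 =
          int \<Delta> ^ 3 * int k - 2 * int \<Delta> ^ 2 * int k - 3 * int \<Delta> * int k + 6 * int k
            + 4 * int \<Delta> + int j ^ 3 - int j ^ 2 - 6)"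
proof -
  have "1 \<le> k" using assms(1,3) by linarith
  then show ?thesis
    using sigma_index_family1[OF assms(1,2) _ assms(4,5)] sigma_index_family2[OF assms(1,2) _ assms(4,5)]
      sigma_index_family3[OF assms(1,2)]
    by blast
qed

end
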